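(* Let $f:\mathbb{F}_2^d\to\mathbb{F}_2$ be $k$-th order sensitive at the point $\mathbf{y}=(y_1,\dots,y_d)$ and have real polynomial degree $p$. Define $\mathbf{y}^1=\mathbf{y}$ and, for $i\ge2$, $\mathbf{y}^i\in\mathbb{F}_2^{d^i}$ as the concatenation of $d$ copies of $\mathbf{y}^{i-1}$. Define $f^1=f$ and, for $i\ge 2$, $f^i:\mathbb{F}_2^{d^i}\to\mathbb{F}_2$ by $f^i(x_1,\dots,x_{d^i})=f(z_1,\dots,z_d)$ where, for $1\le j\le d$, $z_j=f^{i-1}(x_{(j-1)d^{i-1}+1},\dots,x_{jd^{i-1}})\oplus f^{i-1}(\mathbf{y}^{i-1})\oplus y_j$. Then for every $u\ge1$, $f^u$ is a function on $n=d^u$ variables which is $k$-th order sensitive at the point $\mathbf{y}^u$, and $\mathrm{pdeg}(f^u)=p^u$.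
   Context: $\mathrm{pdeg}(h)$ denotes the real polynomial degree of a Boolean function $h$, i.e. the degree of the unique multilinear real polynomial agreeing with $h$ on $\{0,1\}^n$. For $S\subseteq[n]$, $\mathbf{x}^{(S)}$ is $\mathbf{x}$ with the bits in $S$ flipped. A function $h$ is $k$-th order sensitive at $\mathbf{x}$ if $h(\mathbf{x})\ne h(\mathbf{x}^{(S)})$ for all $S\subseteq[n]$ with $1\le|S|\le k$. *)

theory Defs
  imports Complex_Main "HOL-Library.Z2"
begin

text \<open>
  A point of \<open>\<F>\<^sub>2\<^sup>n\<close> is a \<^typ>\<open>bit list\<close> of length \<open>n\<close>, and a Boolean function on \<open>n\<close> variables
  is a function \<^typ>\<open>bit list \<Rightarrow> bit\<close>, of which only the values on lists of length \<open>n\<close> are ever used.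
  The coordinates \<open>1, \<dots>, n\<close> become the positions \<open>0, \<dots>, n - 1\<close>. Addition of bits is exclusive or.
\<close>

definition flip_bits :: "nat set \<Rightarrow> bit list \<Rightarrow> bit list" where
  "flip_bits S x = map (\<lambda>i. if i \<in> S then x ! i + 1 else x ! i) [0..<length x]"

definition order_sensitive :: "nat \<Rightarrow> nat \<Rightarrow> (bit list \<Rightarrow> bit) \<Rightarrow> bit list \<Rightarrow> bool" where
  "order_sensitive n k h x \<longleftrightarrow>
     (\<forall>S. S \<subseteq> {..<n} \<and> 1 \<le> card S \<and> card S \<le> k \<longrightarrow> h x \<noteq> h (flip_bits S x))"

text \<open>
  A multilinear real polynomial in \<open>n\<close> variables is given by its coefficients: \<open>c S\<close> is the
  coefficient of the monomial \<open>\<Prod>i\<in>S. X i\<close>.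
\<close>

definition multilinear :: "nat \<Rightarrow> (nat set \<Rightarrow> real) \<Rightarrow> bool" where
  "multilinear n c \<longleftrightarrow> (\<forall>S. c S \<noteq> 0 \<longrightarrow> S \<subseteq> {..<n})"

definition ml_eval :: "nat \<Rightarrow> (nat set \<Rightarrow> real) \<Rightarrow> (nat \<Rightarrow> real) \<Rightarrow> real" where
  "ml_eval n c v = (\<Sum>S\<in>Pow {..<n}. c S * (\<Prod>i\<in>S. v i))"

text \<open>The zero polynomial is given degree 0.\<close>

definition ml_degree :: "(nat set \<Rightarrow> real) \<Rightarrow> nat" where
  "ml_degree c = Max (insert 0 (card ` {S. c S \<noteq> 0}))"

definition represents :: "nat \<Rightarrow> (nat set \<Rightarrow> real) \<Rightarrow> (bit list \<Rightarrow> bit) \<Rightarrow> bool" where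
  "represents n c h \<longleftrightarrow>
     multilinear n c \<and> (\<forall>x. length x = n \<longrightarrow> ml_eval n c (\<lambda>i. of_bit (x ! i)) = of_bit (h x))"

definition pdeg :: "nat \<Rightarrow> (bit list \<Rightarrow> bit) \<Rightarrow> nat" where
  "pdeg n h = ml_degree (THE c. represents n c h)"

text \<open>The definite description in the definition of \<open>pdeg\<close> is well-defined.\<close>

lemma represents_iff_sums:
  "represents n c h \<longleftrightarrow> multilinear n c \<and>
     (\<forall>T\<subseteq>{..<n}. sum c (Pow T) = of_bit (h (map (\<lambda>i. of_bool (i \<in> T)) [0..<n])))"
proof -
  let ?x = "\<lambda>T. map (\<lambda>i. of_bool (i \<in> T) :: bit) [0..<n]"
  have ev: "ml_eval n c (\<lambda>i. of_bit (?x T ! i)) = sum c (Pow T)" if "T \<subseteq> {..<n}" for T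
  proof -
    have "c S * (\<Prod>i\<in>S. of_bit (?x T ! i)) = (if S \<subseteq> T then c S else 0)" if "S \<subseteq> {..<n}" for S
    proof -
      have "finite S" using that finite_subset by blast
      have "(\<Prod>i\<in>S. of_bit (?x T ! i)) = (\<Prod>i\<in>S. of_bool (i \<in> T) :: real)"
        using that by (intro prod.cong) auto
      also have "\<dots> = of_bool (S \<subseteq> T)"
        using \<open>finite S\<close> by (auto intro!: prod.neutral)
      finally show ?thesis by simp
    qed
    then have "ml_eval n c (\<lambda>i. of_bit (?x T ! i)) = (\<Sum>S\<in>Pow {..<n}. if S \<subseteq> T then c S else 0)"
      unfolding ml_eval_def by (intro sum.cong) auto
    also have "\<dots> = sum c {S \<in> Pow {..<n}. S \<subseteq> T}"
      by (rule sum.inter_filter [symmetric]) simp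
    also have "{S \<in> Pow {..<n}. S \<subseteq> T} = Pow T"
      using that by auto
    finally show ?thesis .
  qed
  have all: "(\<forall>x. length x = n \<longrightarrow> P x) \<longleftrightarrow> (\<forall>T\<subseteq>{..<n}. P (?x T))" for P
  proof (intro iffI allI impI)
    fix x :: "bit list"
    assume *: "\<forall>T\<subseteq>{..<n}. P (?x T)" and len: "length x = n"
    define T where "T = {i. i < n \<and> x ! i = 1}"
    have "?x T = x"
      using len by (intro nth_equalityI) (auto simp: T_def)
    moreover have "P (?x T)"
      using *[rule_format, of T] unfolding T_def by blast
    ultimately show "P x" by metis
  next
    fix T :: "nat set"
    assume "\<forall>x. length x = n \<longrightarrow> P x"
    then show "P (?x T)" by (metis diff_zero length_map length_upt)
  qed
  have "represents n c h \<longleftrightarrow> multilinear n c \<and>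
      (\<forall>T\<subseteq>{..<n}. ml_eval n c (\<lambda>i. of_bit (?x T ! i)) = of_bit (h (?x T)))"
    unfolding represents_def by (subst all) (rule refl)
  then show ?thesis
    using ev by metis
qed

lemma ex1_represents: "\<exists>!c. represents n c h"
proof -
  define g where "g T = (of_bit (h (map (\<lambda>i. of_bool (i \<in> T)) [0..<n])) :: real)" for T :: "nat set"
  define c where "c S = (if S \<subseteq> {..<n} then (-1) ^ card S * (\<Sum>T\<in>Pow S. (-1) ^ card T * g T) else 0)"
    for S
  have "sum c (Pow T) = g T" if "T \<subseteq> {..<n}" for T
  proof -
    have "finite T" using that finite_subset by blast
    have "g T = (\<Sum>S\<in>Pow T. (-1) ^ card S * (\<Sum>U\<in>Pow S. (-1) ^ card U * g U))"
      by (rule inclusion_exclusion_symmetric) (use \<open>finite T\<close> in auto)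
    also have "\<dots> = sum c (Pow T)"
      using that by (intro sum.cong) (auto simp: c_def)
    finally show ?thesis by simp
  qed
  then have "represents n c h"
    by (auto simp: represents_iff_sums multilinear_def c_def g_def)
  moreover have "a = b" if a: "represents n a h" and b: "represents n b h" for a b
  proof
    fix S
    show "a S = b S"
    proof (cases "S \<subseteq> {..<n}")
      case True
      then have "finite S" using finite_subset by blast
      then show ?thesis using True
      proof (induction S rule: finite_psubset_induct)
        case (psubset S)
        have "sum a (Pow S) = sum b (Pow S)"
          using a b psubset.prems by (simp add: represents_iff_sums)
        moreover have "sum a (Pow S - {S}) = sum b (Pow S - {S})"
          using psubset by (intro sum.cong) auto
        ultimately show ?case
          using psubset.hyps by (simp add: sum.remove[of "Pow S" S])
      qed
    next
      case False
      then show ?thesis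
        using a b unfolding represents_def multilinear_def by metis
    qed
  qed
  ultimately show ?thesis by blast
qed

text \<open>The iterates are indexed from 1; the values at index 0 are left unspecified.\<close>

fun iter_point :: "nat \<Rightarrow> bit list \<Rightarrow> nat \<Rightarrow> bit list" where
  "iter_point d y (Suc 0) = y"
| "iter_point d y (Suc (Suc i)) = concat (replicate d (iter_point d y (Suc i)))"

fun iter_fun :: "nat \<Rightarrow> (bit list \<Rightarrow> bit) \<Rightarrow> bit list \<Rightarrow> nat \<Rightarrow> bit list \<Rightarrow> bit" where
  "iter_fun d f y (Suc 0) x = f x"
| "iter_fun d f y (Suc (Suc i)) x =
     f (map (\<lambda>j. iter_fun d f y (Suc i) (take (d ^ Suc i) (drop (j * d ^ Suc i) x))
                 + iter_fun d f y (Suc i) (iter_point d y (Suc i)) + y ! j) [0..<d])"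

end

(* Composition with inner functions on disjoint blocks of variables turns multilinear polynomials
   into a multilinear polynomial, so no reduction X^2 = X takes place. A top monomial S of the outer
   polynomial, together with top monomials of the inner ones for the blocks in S, gives a monomial
   to which no other outer monomial contributes: those missing a block of S cannot produce it, and
   proper supersets of S exceed the degree. Hence degrees multiply. Adding a constant bit replaces
   an inner polynomial q by q or 1 - q, which preserves its degree.

   For sensitivity, the added constants make the outer function read y at the iterated point, and
   flipping a small nonempty set of bits flips exactly those outer bits whose block it meets. *)

theory Submission
  imports Defs "HOL-Library.FuncSet"
begin

section \<open>Blocks of variables\<close>

text \<open>Positions are shifted down to start at 0, so that the block of a monomial can be fed
  directly to the coefficients of an inner polynomial in \<open>m\<close> variables.\<close>

definition block :: "nat \<Rightarrow> nat set \<Rightarrow> nat \<Rightarrow> nat set" where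
  "block m U j = {i. i < m \<and> j * m + i \<in> U}"

text \<open>This is the slice that occurs in the recursion of \<open>iter_fun\<close>, so unfolding
  alone exhibits an iterate as a block composition.\<close>

definition list_block :: "nat \<Rightarrow> 'a list \<Rightarrow> nat \<Rightarrow> 'a list" where
  "list_block m x j = take m (drop (j * m) x)"

lemma block_subset: "block m U j \<subseteq> {..<m}"
  by (auto simp: block_def)

lemma finite_block [simp]: "finite (block m U j)"
  by (rule finite_subset[OF block_subset]) simp

lemma block_index_less:
  fixes i j d m :: nat
  assumes "j < d" "i < m"
  shows "j * m + i < d * m"
proof -
  have "j * m + i < Suc j * m"
    using assms by simp
  also have "\<dots> \<le> d * m"
    using assms by (intro mult_le_mono1) simp
  finally show ?thesis .
qed

lemma block_index_eq_iff:
  fixes i i' j j' m :: nat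
  assumes "i < m" "i' < m"
  shows "j * m + i = j' * m + i' \<longleftrightarrow> j = j' \<and> i = i'"
proof
  assume eq: "j * m + i = j' * m + i'"
  have "(j * m + i) div m = j" "(j' * m + i') div m = j'"
    using assms by auto
  with eq show "j = j' \<and> i = i'" by simp
qed simp

text \<open>Division with remainder by \<open>m\<close> provides preimages. Through this bijection
  cardinalities and products over \<open>U\<close> split into blocks.\<close>

lemma bij_betw_blocks:
  assumes "U \<subseteq> {..<d * m}"
  shows "bij_betw (\<lambda>(j, i). j * m + i) (SIGMA j:{..<d}. block m U j) U"
proof (rule bij_betwI')
  fix x y
  assume "x \<in> (SIGMA j:{..<d}. block m U j)" "y \<in> (SIGMA j:{..<d}. block m U j)"
  then show "(case x of (j, i) \<Rightarrow> j * m + i) = (case y of (j, i) \<Rightarrow> j * m + i) \<longleftrightarrow> x = y"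
    using block_index_eq_iff by (auto simp: block_def)
next
  fix x
  assume "x \<in> (SIGMA j:{..<d}. block m U j)"
  then show "(case x of (j, i) \<Rightarrow> j * m + i) \<in> U"
    by (auto simp: block_def)
next
  fix u
  assume u: "u \<in> U"
  then have less: "u < d * m" using assms by auto
  then have "m > 0" by (cases m) auto
  have "u div m < d"
    using less by (simp add: less_mult_imp_div_less)
  moreover have "u mod m \<in> block m U (u div m)"
    using u \<open>m > 0\<close> by (simp add: block_def)
  ultimately show "\<exists>x\<in>SIGMA j:{..<d}. block m U j. u = (case x of (j, i) \<Rightarrow> j * m + i)"
    by (intro bexI[of _ "(u div m, u mod m)"]) auto
qed

lemma card_eq_sum_blocks:
  assumes "U \<subseteq> {..<d * m}"
  shows "card U = (\<Sum>j<d. card (block m U j))"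
  using bij_betw_same_card[OF bij_betw_blocks[OF assms]] by (simp add: card_SigmaI)

lemma prod_eq_prod_blocks:
  assumes "U \<subseteq> {..<d * m}"
  shows "(\<Prod>u\<in>U. v u) = (\<Prod>j<d. \<Prod>i\<in>block m U j. v (j * m + i))"
  using prod.reindex_bij_betw[OF bij_betw_blocks[OF assms], of v]
  by (simp add: prod.Sigma case_prod_unfold)

text \<open>Assembles a set from prescribed blocks. It serves both to invert the block decomposition
  and to build a top monomial of a composition.\<close>

lemma block_UN:
  assumes "\<And>j. j \<in> S \<Longrightarrow> T j \<subseteq> {..<m}"
  shows "block m (\<Union>j\<in>S. (\<lambda>i. j * m + i) ` T j) j = (if j \<in> S then T j else {})"
proof -
  have "j * m + i \<in> (\<Union>j\<in>S. (\<lambda>i. j * m + i) ` T j) \<longleftrightarrow> j \<in> S \<and> i \<in> T j" if "i < m" for i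
    using assms block_index_eq_iff[of i m _ j] that by (fastforce simp: subset_eq)
  then show ?thesis
    using assms by (auto simp: block_def)
qed

lemma UN_blocks_subset:
  fixes d m :: nat
  assumes "S \<subseteq> {..<d}" "\<And>j. j \<in> S \<Longrightarrow> T j \<subseteq> {..<m}"
  shows "(\<Union>j\<in>S. (\<lambda>i. j * m + i) ` T j) \<subseteq> {..<d * m}"
  using assms by (auto intro!: block_index_less)

text \<open>The blocks of a set can be chosen independently, so a sum over all monomials of a
  product over blocks factors. The restriction to \<open>{..<d}\<close> makes the block function
  extensional, as membership in the function space demands.\<close>

lemma bij_betw_Pow_blocks:
  "bij_betw (\<lambda>U. \<lambda>j\<in>{..<d}. block m U j) (Pow {..<d * m}) ({..<d} \<rightarrow>\<^sub>E Pow {..<m})"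
proof (rule bij_betw_byWitness[where f' = "\<lambda>g. \<Union>j<d. (\<lambda>i. j * m + i) ` g j"])
  show "\<forall>U\<in>Pow {..<d * m}. (\<Union>j<d. (\<lambda>i. j * m + i) ` (\<lambda>j\<in>{..<d}. block m U j) j) = U"
  proof
    fix U
    assume "U \<in> Pow {..<d * m}"
    then have "(\<lambda>(j, i). j * m + i) ` (SIGMA j:{..<d}. block m U j) = U"
      using bij_betw_blocks[of U d m] by (simp add: bij_betw_def)
    then show "(\<Union>j<d. (\<lambda>i. j * m + i) ` (\<lambda>j\<in>{..<d}. block m U j) j) = U"
      by fastforce
  qed
next
  show "\<forall>g\<in>{..<d} \<rightarrow>\<^sub>E Pow {..<m}.
      (\<lambda>j\<in>{..<d}. block m (\<Union>j<d. (\<lambda>i. j * m + i) ` g j) j) = g"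
  proof
    fix g
    assume g: "g \<in> {..<d} \<rightarrow>\<^sub>E Pow {..<m}"
    then have "\<And>j. j \<in> {..<d} \<Longrightarrow> g j \<subseteq> {..<m}" by auto
    from block_UN[of "{..<d}" g m, OF this]
    show "(\<lambda>j\<in>{..<d}. block m (\<Union>j<d. (\<lambda>i. j * m + i) ` g j) j) = g"
      using g by (auto simp: fun_eq_iff PiE_def extensional_def)
  qed
next
  show "(\<lambda>U. \<lambda>j\<in>{..<d}. block m U j) ` Pow {..<d * m} \<subseteq> {..<d} \<rightarrow>\<^sub>E Pow {..<m}"
    using block_subset by fastforce
next
  show "(\<lambda>g. \<Union>j<d. (\<lambda>i. j * m + i) ` g j) ` ({..<d} \<rightarrow>\<^sub>E Pow {..<m}) \<subseteq> Pow {..<d * m}"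
  proof (rule image_subsetI)
    fix g :: "nat \<Rightarrow> nat set"
    assume g: "g \<in> {..<d} \<rightarrow>\<^sub>E Pow {..<m}"
    have "(\<Union>j<d. (\<lambda>i. j * m + i) ` g j) \<subseteq> {..<d * m}"
      by (rule UN_blocks_subset) (use g in auto)
    then show "(\<Union>j<d. (\<lambda>i. j * m + i) ` g j) \<in> Pow {..<d * m}" by simp
  qed
qed

lemma length_list_block:
  assumes "length x = d * m" "j < d"
  shows "length (list_block m x j) = m"
proof -
  have "Suc j * m \<le> d * m"
    using assms by (intro mult_le_mono1) simp
  then show ?thesis
    using assms by (simp add: list_block_def)
qed

lemma nth_list_block:
  assumes "length x = d * m" "j < d" "i < m"
  shows "list_block m x j ! i = x ! (j * m + i)"
  using assms block_index_less[of j d i m] by (simp add: list_block_def)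

lemma list_block_concat_replicate:
  assumes "length w = m" "j < d"
  shows "list_block m (concat (replicate d w)) j = w"
proof -
  have "replicate d w = replicate j w @ w # replicate (d - Suc j) w"
    using replicate_add[of j "Suc (d - Suc j)" w] \<open>j < d\<close> by simp
  then have "concat (replicate d w) = concat (replicate j w) @ w @ concat (replicate (d - Suc j) w)"
    by simp
  moreover have "length (concat (replicate j w)) = j * m"
    using assms by (simp add: length_concat sum_list_replicate)
  ultimately show ?thesis
    using assms by (simp add: list_block_def)
qed

section \<open>Degrees of multilinear polynomials\<close>

lemma finite_support:
  assumes "multilinear n c"
  shows "finite {S. c S \<noteq> 0}"
  by (rule finite_subset[of _ "Pow {..<n}"]) (use assms in \<open>auto simp: multilinear_def\<close>)

lemma card_le_ml_degree:
  assumes "multilinear n c" "c S \<noteq> 0"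
  shows "card S \<le> ml_degree c"
  unfolding ml_degree_def using finite_support[OF assms(1)] assms(2) by (intro Max_ge) auto

lemma ml_degree_le:
  assumes "multilinear n c" "\<And>S. c S \<noteq> 0 \<Longrightarrow> card S \<le> N"
  shows "ml_degree c \<le> N"
  unfolding ml_degree_def using finite_support[OF assms(1)] assms(2) by (intro Max.boundedI) auto

text \<open>Positivity excludes the case where the maximum is only the default 0 of the zero
  polynomial.\<close>

lemma ml_degree_attained:
  assumes "multilinear n c" "ml_degree c > 0"
  obtains S where "c S \<noteq> 0" "card S = ml_degree c"
proof -
  have "ml_degree c \<in> insert 0 (card ` {S. c S \<noteq> 0})"
    unfolding ml_degree_def using finite_support[OF assms(1)] by (intro Max_in) auto
  with assms(2) show thesis
    using that by fastforce
qed

lemma ml_eval_cong: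
  assumes "\<And>i. i < n \<Longrightarrow> v i = w i"
  shows "ml_eval n c v = ml_eval n c w"
  unfolding ml_eval_def using assms by (intro sum.cong arg_cong2[where f = "(*)"] prod.cong) auto

lemma pdeg_eq_ml_degree:
  assumes "represents n c h"
  shows "pdeg n h = ml_degree c"
  unfolding pdeg_def by (simp add: the1_equality[OF ex1_represents, of n c h] assms)

text \<open>Complementing a bit \<open>b\<close> is the real map 1 - \<open>b\<close>, and the
  constant polynomial 1 has its only coefficient at the empty set.\<close>

lemma represents_add_one:
  assumes "represents n c h"
  shows "represents n (\<lambda>S. of_bool (S = {}) - c S) (\<lambda>x. h x + 1)"
proof -
  have ev: "ml_eval n (\<lambda>S. of_bool (S = {}) - c S) v = 1 - ml_eval n c v" for v
  proof -
    have "ml_eval n (\<lambda>S. of_bool (S = {}) - c S) v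
        = (\<Sum>S\<in>Pow {..<n}. if S = {} then 1 else 0) - ml_eval n c v"
      unfolding ml_eval_def sum_subtractf[symmetric]
      by (intro sum.cong) (auto simp: algebra_simps)
    then show ?thesis by (simp add: sum.delta)
  qed
  have bit: "(of_bit (b + 1) :: real) = 1 - of_bit b" for b :: bit
    by (cases b) auto
  show ?thesis
    using assms by (auto simp: represents_def multilinear_def ev bit)
qed

text \<open>Apart from signs only the constant coefficient changes, and the empty monomial cannot
  raise a degree.\<close>

lemma pdeg_add_one_le: "pdeg n (\<lambda>x. h x + 1) \<le> pdeg n h"
proof -
  obtain c where c: "represents n c h"
    using ex1_represents by blast
  note c' = represents_add_one[OF c]
  have "ml_degree (\<lambda>S. of_bool (S = {}) - c S) \<le> ml_degree c"
  proof (rule ml_degree_le)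
    show "multilinear n (\<lambda>S. of_bool (S = {}) - c S)"
      using c' by (simp add: represents_def)
    fix S
    assume "of_bool (S = {}) - c S \<noteq> 0"
    then show "card S \<le> ml_degree c"
      using c card_le_ml_degree[of n c S] by (cases "S = {}") (auto simp: represents_def)
  qed
  then show ?thesis
    unfolding pdeg_eq_ml_degree[OF c] pdeg_eq_ml_degree[OF c'] .
qed

lemma pdeg_add_const: "pdeg n (\<lambda>x. h x + b) = pdeg n h"
proof (cases b)
  case one
  \<comment> \<open>Complementing twice gives back \<open>h\<close>, so the inequality applied to
    the complement is the reverse one.\<close>
  have "pdeg n (\<lambda>x. (h x + 1) + 1) \<le> pdeg n (\<lambda>x. h x + 1)"
    by (rule pdeg_add_one_le)
  moreover have "(\<lambda>x. (h x + 1) + 1) = h"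
    by (simp add: fun_eq_iff add.assoc del: bit_iff_odd)
  ultimately have "pdeg n h \<le> pdeg n (\<lambda>x. h x + 1)"
    by (simp only:)
  with pdeg_add_one_le[of n h] one show ?thesis by simp
qed (simp only: add_0_right)

section \<open>Block composition\<close>

text \<open>The factor for \<open>j \<notin> S\<close> forces the monomial to avoid the blocks that \<open>S\<close> does not use.\<close>

definition ml_compose ::
  "nat \<Rightarrow> nat \<Rightarrow> (nat set \<Rightarrow> real) \<Rightarrow> (nat \<Rightarrow> nat set \<Rightarrow> real) \<Rightarrow> nat set \<Rightarrow> real" where
  "ml_compose d m c a U = (if U \<subseteq> {..<d * m}
     then \<Sum>S\<in>Pow {..<d}. c S *
       (\<Prod>j<d. if j \<in> S then a j (block m U j) else of_bool (block m U j = {}))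
     else 0)"

lemma multilinear_ml_compose: "multilinear (d * m) (ml_compose d m c a)"
  by (auto simp: multilinear_def ml_compose_def)

text \<open>Substituting the inner polynomials into an outer monomial \<open>S\<close> and expanding
  picks one inner monomial for each block in \<open>S\<close>; distinct choices give distinct sets
  \<open>U\<close>. Hence the identity holds at every real point \<open>v\<close>, not only at
  bits.\<close>

lemma ml_eval_ml_compose:
  "ml_eval (d * m) (ml_compose d m c a) v
     = ml_eval d c (\<lambda>j. ml_eval m (a j) (\<lambda>i. v (j * m + i)))"
proof -
  \<comment> \<open>\<open>F S j T\<close> is what block \<open>j\<close> contributes to the term of
    \<open>S\<close> when \<open>U\<close> meets that block in \<open>T\<close>. For
    \<open>j\<close> outside \<open>S\<close> only \<open>T = {}\<close> contributes, with value
    1.\<close>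
  define F where "F S j T = (if j \<in> S then a j T else of_bool (T = {})) *
      (\<Prod>i\<in>T. v (j * m + i))" for S j T
  have F_sum: "(\<Sum>T\<in>Pow {..<m}. F S j T)
      = (if j \<in> S then ml_eval m (a j) (\<lambda>i. v (j * m + i)) else 1)" for S j
  proof (cases "j \<in> S")
    case False
    then have "(\<Sum>T\<in>Pow {..<m}. F S j T) = (\<Sum>T\<in>Pow {..<m}. if T = {} then 1 else 0)"
      unfolding F_def by (intro sum.cong) auto
    with False show ?thesis by (simp add: sum.delta)
  qed (simp add: F_def ml_eval_def)
  have "ml_eval (d * m) (ml_compose d m c a) v
      = (\<Sum>U\<in>Pow {..<d * m}. \<Sum>S\<in>Pow {..<d}. c S * (\<Prod>j<d. F S j (block m U j)))"
    unfolding ml_eval_def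
    by (intro sum.cong)
      (auto simp: ml_compose_def sum_distrib_right prod_eq_prod_blocks prod.distrib F_def mult.assoc)
  also have "\<dots> = (\<Sum>S\<in>Pow {..<d}. c S * (\<Sum>U\<in>Pow {..<d * m}. \<Prod>j<d. F S j (block m U j)))"
    by (subst sum.swap) (simp add: sum_distrib_left)
  also have "\<dots> = (\<Sum>S\<in>Pow {..<d}. c S * (\<Prod>j\<in>S. ml_eval m (a j) (\<lambda>i. v (j * m + i))))"
  proof (intro sum.cong refl arg_cong2[where f = "(*)"])
    fix S
    assume S: "S \<in> Pow {..<d}"
    have "(\<Sum>U\<in>Pow {..<d * m}. \<Prod>j<d. F S j (block m U j))
        = (\<Sum>U\<in>Pow {..<d * m}. \<Prod>j<d. F S j ((\<lambda>j\<in>{..<d}. block m U j) j))"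
      by simp
    also have "\<dots> = (\<Sum>g\<in>{..<d} \<rightarrow>\<^sub>E Pow {..<m}. \<Prod>j<d. F S j (g j))"
      by (rule sum.reindex_bij_betw[OF bij_betw_Pow_blocks])
    also have "\<dots> = (\<Prod>j<d. \<Sum>T\<in>Pow {..<m}. F S j T)"
      by (rule prod_sum_PiE[symmetric]) auto
    also have "\<dots> = (\<Prod>j\<in>{..<d} \<inter> S. ml_eval m (a j) (\<lambda>i. v (j * m + i)))"
      unfolding F_sum by (rule prod.inter_restrict[symmetric]) simp
    also have "{..<d} \<inter> S = S" using S by auto
    finally show "(\<Sum>U\<in>Pow {..<d * m}. \<Prod>j<d. F S j (block m U j))
        = (\<Prod>j\<in>S. ml_eval m (a j) (\<lambda>i. v (j * m + i)))" .
  qed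
  finally show ?thesis by (simp add: ml_eval_def)
qed

text \<open>At a bit point all inner polynomials take bit values, and at such values
  \<open>c\<close> agrees with \<open>f\<close>.\<close>

lemma represents_ml_compose:
  assumes c: "represents d c f" and a: "\<And>j. j < d \<Longrightarrow> represents m (a j) (h j)"
  shows "represents (d * m) (ml_compose d m c a)
    (\<lambda>x. f (map (\<lambda>j. h j (list_block m x j)) [0..<d]))"
  unfolding represents_def
proof (intro conjI allI impI multilinear_ml_compose)
  fix x :: "bit list"
  assume len: "length x = d * m"
  let ?z = "map (\<lambda>j. h j (list_block m x j)) [0..<d]"
  have "ml_eval m (a j) (\<lambda>i. of_bit (x ! (j * m + i))) = of_bit (?z ! j)" if "j < d" for j
  proof -
    have "ml_eval m (a j) (\<lambda>i. of_bit (x ! (j * m + i)))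
        = ml_eval m (a j) (\<lambda>i. of_bit (list_block m x j ! i))"
      using nth_list_block[OF len that] by (intro ml_eval_cong) simp
    also have "\<dots> = of_bit (h j (list_block m x j))"
      using a[OF that] length_list_block[OF len that] by (simp add: represents_def)
    finally show ?thesis using that by simp
  qed
  then have "ml_eval (d * m) (ml_compose d m c a) (\<lambda>i. of_bit (x ! i))
      = ml_eval d c (\<lambda>j. of_bit (?z ! j))"
    unfolding ml_eval_ml_compose by (intro ml_eval_cong)
  also have "\<dots> = of_bit (f ?z)"
    using c by (simp add: represents_def)
  finally show "ml_eval (d * m) (ml_compose d m c a) (\<lambda>i. of_bit (x ! i)) = of_bit (f ?z)" .
qed

text \<open>Variables are counted block by block: a contributing outer monomial uses at most
  \<open>ml_degree c\<close> blocks with at most \<open>q\<close> variables each, and top monomials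
  attain both bounds.\<close>

lemma ml_degree_ml_compose:
  assumes c: "multilinear d c"
    and a: "\<And>j. j < d \<Longrightarrow> multilinear m (a j)"
    and deg: "\<And>j. j < d \<Longrightarrow> ml_degree (a j) = q"
  shows "ml_degree (ml_compose d m c a) = ml_degree c * q"
proof (rule antisym)
  show "ml_degree (ml_compose d m c a) \<le> ml_degree c * q"
  proof (rule ml_degree_le[OF multilinear_ml_compose])
    fix U
    assume nz: "ml_compose d m c a U \<noteq> 0"
    then have U: "U \<subseteq> {..<d * m}"
      by (auto simp: ml_compose_def split: if_splits)
    let ?B = "\<lambda>S j. if j \<in> S then a j (block m U j) else of_bool (block m U j = {})"
    \<comment> \<open>Some outer monomial \<open>S\<close> contributes to \<open>U\<close>. Its
      factors being nonzero, \<open>U\<close> is empty on the blocks outside \<open>S\<close> and a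
      monomial of \<open>a j\<close> on each block \<open>j\<close> in \<open>S\<close>.\<close>
    obtain S where S: "S \<subseteq> {..<d}" "c S * (\<Prod>j<d. ?B S j) \<noteq> 0"
      using nz U by (auto simp: ml_compose_def elim: sum.not_neutral_contains_not_neutral)
    then have "c S \<noteq> 0" and B: "?B S j \<noteq> 0" if "j < d" for j
      using that by (auto simp: prod_zero_iff)
    have "card U = (\<Sum>j<d. card (block m U j))"
      by (rule card_eq_sum_blocks[OF U])
    also have "\<dots> = (\<Sum>j\<in>S. card (block m U j))"
      by (rule sum.mono_neutral_right) (use S B in \<open>fastforce simp: card_eq_0_iff\<close>)+
    also have "\<dots> \<le> (\<Sum>j\<in>S. q)"
    proof (rule sum_mono)
      fix j
      assume "j \<in> S"
      then have "j < d" using S by auto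
      then show "card (block m U j) \<le> q"
        using B[of j] \<open>j \<in> S\<close> card_le_ml_degree[OF a, of j "block m U j"] deg[of j] by auto
    qed
    also have "\<dots> \<le> ml_degree c * q"
      using card_le_ml_degree[OF c, of S] S(2) by auto
    finally show "card U \<le> ml_degree c * q" .
  qed
next
  show "ml_degree c * q \<le> ml_degree (ml_compose d m c a)"
  proof (cases "ml_degree c * q = 0")
    case False
    then have pos: "ml_degree c > 0" "q > 0" by auto
    obtain S where S: "c S \<noteq> 0" "card S = ml_degree c"
      using ml_degree_attained[OF c pos(1)] .
    then have sub: "S \<subseteq> {..<d}" using c by (auto simp: multilinear_def)
    have "\<exists>T. a j T \<noteq> 0 \<and> card T = q" if "j < d" for j
      using ml_degree_attained[OF a[OF that]] deg[OF that] pos(2) by metis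
    then obtain T where T: "a j (T j) \<noteq> 0" "card (T j) = q" if "j < d" for j
      by metis
    have T_sub: "T j \<subseteq> {..<m}" if "j \<in> S" for j
      using T(1)[of j] a[of j] sub that by (auto simp: multilinear_def)
    \<comment> \<open>This is where \<open>q > 0\<close> enters: an outer monomial that misses a
      block of \<open>S\<close> fails to produce \<open>U\<close> only because \<open>U\<close> is
      nonempty there.\<close>
    have T_ne: "T j \<noteq> {}" if "j \<in> S" for j
      using T(2)[of j] sub that pos(2) by auto
    define U where "U = (\<Union>j\<in>S. (\<lambda>i. j * m + i) ` T j)"
    have U: "U \<subseteq> {..<d * m}"
      unfolding U_def by (rule UN_blocks_subset[OF sub T_sub])
    have block_U: "block m U j = (if j \<in> S then T j else {})" for j
      unfolding U_def by (rule block_UN[OF T_sub])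
    let ?B = "\<lambda>R j. if j \<in> R then a j (block m U j) else of_bool (block m U j = {})"
    have "c R * (\<Prod>j<d. ?B R j) = 0" if R: "R \<subseteq> {..<d}" "R \<noteq> S" for R
    proof (cases "S \<subseteq> R")
      case True
      have "finite R" using R finite_subset by blast
      then have "card S < card R"
        using True R by (intro psubset_card_mono) auto
      then have "c R = 0"
        using card_le_ml_degree[OF c, of R] S(2) by fastforce
      then show ?thesis by simp
    next
      case False
      then obtain j where j: "j \<in> S" "j \<notin> R" by auto
      then have "?B R j = 0" using T_ne by (simp add: block_U)
      then show ?thesis using j sub by (auto simp: prod_zero_iff)
    qed
    then have "(\<Sum>R\<in>Pow {..<d}. c R * (\<Prod>j<d. ?B R j))
        = (\<Sum>R\<in>{S}. c R * (\<Prod>j<d. ?B R j))"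
      using sub by (intro sum.mono_neutral_right) blast+
    \<comment> \<open>Nothing can cancel: the coefficient of \<open>U\<close> is \<open>c S\<close>
      times the chosen top coefficients \<open>a j (T j)\<close> for \<open>j\<close> in
      \<open>S\<close>.\<close>
    then have "ml_compose d m c a U = (\<Sum>R\<in>{S}. c R * (\<Prod>j<d. ?B R j))"
      unfolding ml_compose_def using U by simp
    also have "\<dots> \<noteq> 0"
      using S(1) T(1) by (simp add: block_U prod_zero_iff)
    finally have "card U \<le> ml_degree (ml_compose d m c a)"
      by (rule card_le_ml_degree[OF multilinear_ml_compose])
    moreover have "card U = (\<Sum>j\<in>S. card (T j))"
    proof -
      have "card U = (\<Sum>j<d. card (block m U j))"
        by (rule card_eq_sum_blocks[OF U])
      also have "\<dots> = (\<Sum>j\<in>S. card (block m U j))"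
        by (rule sum.mono_neutral_right) (use sub in \<open>auto simp: block_U\<close>)
      finally show ?thesis by (simp add: block_U)
    qed
    moreover have "(\<Sum>j\<in>S. card (T j)) = (\<Sum>j\<in>S. q)"
      using T(2) sub by (intro sum.cong) auto
    ultimately show ?thesis
      using S(2) by simp
  qed linarith
qed

text \<open>The inner functions may vary with \<open>j\<close> because the iterates add a different
  bit \<open>y ! j\<close> in each block; only their common degree matters.\<close>

lemma pdeg_block_compose:
  assumes "\<And>j. j < d \<Longrightarrow> pdeg m (h j) = q"
  shows "pdeg (d * m) (\<lambda>x. f (map (\<lambda>j. h j (list_block m x j)) [0..<d])) = pdeg d f * q"
proof -
  obtain c where c: "represents d c f"
    using ex1_represents by blast
  define a where "a j = (THE b. represents m b (h j))" for j
  have a: "represents m (a j) (h j)" for j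
    unfolding a_def by (rule theI'[OF ex1_represents])
  have "ml_degree (ml_compose d m c a) = ml_degree c * q"
  proof (rule ml_degree_ml_compose)
    show "multilinear d c" "multilinear m (a j)" for j
      using c a by (simp_all add: represents_def)
    show "ml_degree (a j) = q" if "j < d" for j
      using assms[OF that] pdeg_eq_ml_degree[OF a] by simp
  qed
  then show ?thesis
    by (simp add: pdeg_eq_ml_degree[OF c] pdeg_eq_ml_degree[OF represents_ml_compose[OF c a]])
qed

section \<open>Sensitivity\<close>

lemma flip_bits_empty [simp]: "flip_bits {} x = x"
  by (simp add: flip_bits_def map_nth)

lemma length_flip_bits [simp]: "length (flip_bits S x) = length x"
  by (simp add: flip_bits_def)

lemma nth_flip_bits:
  "i < length x \<Longrightarrow> flip_bits S x ! i = (if i \<in> S then x ! i + 1 else x ! i)"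
  by (simp add: flip_bits_def)

lemma list_block_flip_bits:
  assumes "length x = d * m" "j < d"
  shows "list_block m (flip_bits S x) j = flip_bits (block m S j) (list_block m x j)"
proof (rule nth_equalityI)
  show "length (list_block m (flip_bits S x) j) = length (flip_bits (block m S j) (list_block m x j))"
    using length_list_block[of x d m j] length_list_block[of "flip_bits S x" d m j] assms by simp
  fix i
  assume "i < length (list_block m (flip_bits S x) j)"
  then have i: "i < m"
    using length_list_block[of "flip_bits S x" d m j] assms by simp
  with assms show "list_block m (flip_bits S x) j ! i
      = flip_bits (block m S j) (list_block m x j) ! i"
    using block_index_less[OF assms(2) i]
    by (simp add: nth_list_block length_list_block nth_flip_bits block_def)
qed

text \<open>With two values, being different determines the value. This turns sensitivity of an
  inner function into an equation for the outer input.\<close>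

lemma bit_neq_iff: "a \<noteq> b \<longleftrightarrow> a = b + 1" for a b :: bit
  by (cases a; cases b) auto

text \<open>The order \<open>k\<close> is kept because a set of at most \<open>k\<close> positions
  meets at most \<open>k\<close> blocks, each in at most \<open>k\<close> positions.\<close>

lemma order_sensitive_block_compose:
  assumes y: "length y = d" and f: "order_sensitive d k f y"
    and w: "length w = m" and h: "order_sensitive m k h w"
  shows "order_sensitive (d * m) k
    (\<lambda>x. f (map (\<lambda>j. h (list_block m x j) + h w + y ! j) [0..<d])) (concat (replicate d w))"
proof -
  let ?x = "concat (replicate d w)"
  have len: "length ?x = d * m"
    using w by (simp add: length_concat sum_list_replicate)
  let ?z = "\<lambda>x. map (\<lambda>j. h (list_block m x j) + h w + y ! j) [0..<d]"
  have "f (?z ?x) \<noteq> f (?z (flip_bits S ?x))"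
    if S: "S \<subseteq> {..<d * m}" "1 \<le> card S" "card S \<le> k" for S
  proof -
    \<comment> \<open>\<open>J\<close> collects the outer bits that will flip. Counting one element
      of \<open>S\<close> per block bounds \<open>card J\<close> by \<open>card S\<close>.\<close>
    define J where "J = {j. j < d \<and> block m S j \<noteq> {}}"
    have J: "J \<subseteq> {..<d}" by (auto simp: J_def)
    then have "finite J" using finite_subset by blast
    have card_S: "card S = (\<Sum>j\<in>J. card (block m S j))"
      unfolding card_eq_sum_blocks[OF S(1)]
      by (rule sum.mono_neutral_right) (auto simp: J_def)
    have ge1: "1 \<le> card (block m S j)" if "j \<in> J" for j
      using that by (simp add: J_def Suc_le_eq card_gt_0_iff)
    have "(\<Sum>j\<in>J. 1) \<le> (\<Sum>j\<in>J. card (block m S j))"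
      by (rule sum_mono) (rule ge1)
    then have "card J \<le> k" using card_S S(3) by simp
    moreover have "J \<noteq> {}" using card_S S(2) by auto
    then have "1 \<le> card J" using \<open>finite J\<close> by (simp add: Suc_le_eq card_gt_0_iff)
    ultimately have "f y \<noteq> f (flip_bits J y)"
      using f J by (simp add: order_sensitive_def)
    \<comment> \<open>Each block of the iterated point is \<open>w\<close>, and the two copies of
      \<open>h w\<close> cancel in characteristic 2.\<close>
    moreover have "?z ?x = y"
      by (rule nth_equalityI) (use y w in \<open>auto simp: list_block_concat_replicate\<close>)
    moreover have "?z (flip_bits S ?x) = flip_bits J y"
    proof (rule nth_equalityI)
      fix j
      assume "j < length (?z (flip_bits S ?x))"
      then have j: "j < d" by simp
      have blk: "list_block m (flip_bits S ?x) j = flip_bits (block m S j) w"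
        using list_block_flip_bits[OF len j] list_block_concat_replicate[OF w j] by simp
      \<comment> \<open>A block met by \<open>S\<close> falls under the sensitivity of
        \<open>h\<close> at \<open>w\<close>; on any other block nothing is flipped.\<close>
      have "h (flip_bits (block m S j) w) = (if j \<in> J then h w + 1 else h w)"
      proof (cases "j \<in> J")
        case True
        have "card (block m S j) \<le> card S"
          unfolding card_S using True \<open>finite J\<close> by (intro member_le_sum) auto
        then have "h w \<noteq> h (flip_bits (block m S j) w)"
          using h S(3) ge1[OF True] block_subset by (simp add: order_sensitive_def)
        then show ?thesis
          using True bit_neq_iff[of "h (flip_bits (block m S j) w)" "h w"] by auto
      qed (use j in \<open>simp add: J_def\<close>)
      then show "?z (flip_bits S ?x) ! j = flip_bits J y ! j"
        using j y by (cases "h w") (simp_all add: blk nth_flip_bits add.commute)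
    qed (simp add: y)
    ultimately show ?thesis by simp
  qed
  then show ?thesis
    by (auto simp: order_sensitive_def)
qed

section \<open>Induction over the iterates\<close>

theorem mainTheorem3:
  fixes d k p :: nat and f :: "bit list \<Rightarrow> bit" and y :: "bit list"
  assumes "length y = d"
    and "order_sensitive d k f y"
    and "pdeg d f = p"
  shows "\<forall>u\<ge>1. length (iter_point d y u) = d ^ u
           \<and> order_sensitive (d ^ u) k (iter_fun d f y u) (iter_point d y u)
           \<and> pdeg (d ^ u) (iter_fun d f y u) = p ^ u"
proof (intro allI impI)
  fix u :: nat
  assume "u \<ge> 1"
  then show "length (iter_point d y u) = d ^ u
           \<and> order_sensitive (d ^ u) k (iter_fun d f y u) (iter_point d y u)
           \<and> pdeg (d ^ u) (iter_fun d f y u) = p ^ u"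
  \<comment> \<open>The induction starts at 1, since the iterates at index 0 are
    unspecified.\<close>
  proof (induction u rule: dec_induct)
    case base
    have "iter_fun d f y 1 = f"
      by (simp add: fun_eq_iff)
    then show ?case
      using assms by simp
  next
    case (step u)
    define h w m where "h = iter_fun d f y u" and "w = iter_point d y u" and "m = d ^ u"
    from step.hyps obtain i where i: "u = Suc i"
      by (cases u) auto
    have pt: "iter_point d y (Suc u) = concat (replicate d w)"
      by (simp add: i w_def)
    have fn: "iter_fun d f y (Suc u)
        = (\<lambda>x. f (map (\<lambda>j. h (list_block m x j) + h w + y ! j) [0..<d]))"
      by (simp add: fun_eq_iff i h_def w_def m_def list_block_def)
    have dm: "d ^ Suc u = d * m"
      by (simp add: m_def)
    have IH: "length w = m" "order_sensitive m k h w" "pdeg m h = p ^ u"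
      using step.IH by (simp_all add: h_def w_def m_def)
    have "length (concat (replicate d w)) = d * m"
      using IH by (simp add: length_concat sum_list_replicate)
    \<comment> \<open>In block \<open>j\<close> the inner function is \<open>h\<close> plus the
      constants \<open>h w\<close> and \<open>y ! j\<close>, so it still has degree
      \<open>p ^ u\<close>.\<close>
    moreover have "pdeg (d * m) (\<lambda>x. f (map (\<lambda>j. h (list_block m x j) + h w + y ! j) [0..<d]))
        = p ^ Suc u"
      using pdeg_block_compose[of d m "\<lambda>j x. h x + h w + y ! j" "p ^ u" f] IH(3) assms(3)
      by (simp only: pdeg_add_const power_Suc)
    ultimately show ?case
      unfolding pt fn dm
      using order_sensitive_block_compose[OF assms(1,2) IH(1,2)] by blast
  qed
qed

end
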